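(* Consider the partial backorder inventory system with zero lead time ($\tau=0$). Assume that $\mathbb{P}[D_1=0]=\alpha_0>0$ and $\mathbb{P}[D_1=1]=\alpha_1>0$. For any initial state $X_1=(I_1,B_0)$, there exists a constant $\nu\le1$ such that $$\max_{s}\mathcal{C}^s(r,h;I_1,B_0)-\max_{(s,q)}\mathcal{C}^{(s,q)}(r,h;I_1,B_0)\ \le\ \nu\cdot r\,\mathbb{E}\big(D_{[1,\tau+1]}-s^*\big)^+,\qquad s^*=\arg\max_s\mathcal{C}^s(r,h;I_1,B_0),$$ where, since $\tau=0$, $D_{[1,\tau+1]}=D_1$. Moreover, the $(s,q)$-policy is asymptotically optimal: $$\lim_{r\to\infty}\frac{\max_{s}\mathcal{C}^s(r,h;I_1,B_0)-\max_{(s,q)}\mathcal{C}^{(s,q)}(r,h;I_1,B_0)}{\max_{s}\mathcal{C}^s(r,h;I_1,B_0)}=0.$$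
   Context: Notation: $x^+=\max\{x,0\}$, $x\wedge y=\min(x,y)$, $a_{[i,k]}=\sum_{j=i}^k a_j$ (equal to $0$ if $i>k$). Partial backorder system with zero lead time. The patience parameter is $p\in[0,1]$, the sale price per unit is $r>0$ and the holding cost per unit per period is $h>0$. Demands $D_1,D_2,\dots$ are i.i.d. nonnegative integer-valued with finite mean $d$. For each period $i$, $\{\xi_{i;\ell}:\ell\ge1\}$ are i.i.d. Bernoulli random variables with mean $p$; these families are independent over $i$ and independent of the demands. The state at the beginning of period $i$ is $X_i=(I_i,B_{i-1})$ (on-hand inventory, backorders), nonnegative integers with $I_iB_{i-1}=0$. In period $i$ an order $Q_i\in\{0,1,2,\dots\}$ is placed and arrives immediately; then demand $D_i$ is realized, the unmet demand is $U_i=(B_{i-1}+D_i-I_i-Q_i)^+$ and $I_{i+1}=(I_i+Q_i-B_{i-1}-D_i)^+$; $B_i=\xi_{i;[1,U_i]}$ is backordered and $L_i=U_i-B_i$ is lost. The long-run average profit under a policy $\pi=(Q_1,Q_2,\dots)$ from initial state $(I_1,B_0)$ is $$\mathcal{C}^\pi(r,h;I_1,B_0)=\liminf_{N\to\infty}\frac1N\mathbb{E}\Big[\sum_{i=1}^N \Big(r\cdot\big((I_i+Q_i)\wedge(B_{i-1}+D_i)\big)-h\cdot(I_i+Q_i-B_{i-1}-D_i)^+\Big)\Big].$$ $\mathcal{C}^s$ denotes this quantity under the base-stock policy with level $s$, which orders $Q_i=(s-I_i+B_{i-1})^+$. $\mathcal{C}^{(s,q)}$ denotes it under the $(s,q)$-policy,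 which does not use the backorder $B_{i-1}$ and orders $Q_i=(s+q\cdot\mathbb{I}_{\{I_i=0\}}-I_i)^+$. Here $s,q$ are nonnegative integers. *)

theory Defs
  imports "HOL-Probability.Probability"
begin

text \<open>
  Time is indexed from 1 for the random inputs: \<open>D i\<close> is the demand of period \<open>i \<ge> 1\<close>, and
  \<open>\<xi> i l \<in> {0, 1}\<close> (\<open>i, l \<ge> 1\<close>) tells whether the \<open>l\<close>-th unmet unit of period \<open>i\<close> is backordered.
  The i.i.d. assumptions on the demands and on each patience family, the independence of these
  families over the periods, and their independence of the demands together amount to the mutual
  independence of all the variables, stated here for their disjoint union.
\<close>

locale partial_backorder_system = prob_space M
  for M :: "'a measure" +
  fixes D :: "nat \<Rightarrow> 'a \<Rightarrow> nat"
    and \<xi> :: "nat \<Rightarrow> nat \<Rightarrow> 'a \<Rightarrow> nat"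
    and p :: real
  assumes p_range: "0 \<le> p" "p \<le> 1"
    and independent:
      "indep_vars (\<lambda>_. count_space UNIV)
         (\<lambda>k. case k of Inl i \<Rightarrow> D i | Inr (i, l) \<Rightarrow> \<xi> i l)
         (Inl ` {1..} \<union> Inr ` ({1..} \<times> {1..}))"
    and demand_identically_distributed:
      "\<And>i. i \<ge> 1 \<Longrightarrow> distr M (count_space UNIV) (D i) = distr M (count_space UNIV) (D 1)"
    and demand_finite_mean: "integrable M (\<lambda>\<omega>. real (D 1 \<omega>))"
    and patience_bernoulli:
      "\<And>i l. i \<ge> 1 \<Longrightarrow> l \<ge> 1 \<Longrightarrow>
         distr M (count_space UNIV) (\<xi> i l) = measure_pmf (map_pmf of_bool (bernoulli_pmf p))"

text \<open>
  An ordering rule maps the state \<open>(I\<^sub>i, B\<^sub>i\<^sub>-\<^sub>1)\<close> to the order \<open>Q\<^sub>i\<close>.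
  Subtraction on \<^typ>\<open>nat\<close> is truncated, hence \<open>a - b\<close> is the positive part \<open>(a - b)\<^sup>+\<close>
  throughout; in the base-stock rule \<open>B\<close> is therefore added before \<open>I\<close> is subtracted.
\<close>

type_synonym ordering_rule = "nat \<Rightarrow> nat \<Rightarrow> nat"

definition base_stock :: "nat \<Rightarrow> ordering_rule" where
  "base_stock s I B = (s + B) - I"

definition sq_rule :: "nat \<Rightarrow> nat \<Rightarrow> ordering_rule" where
  "sq_rule s q I B = (s + q * of_bool (I = 0)) - I"

definition next_state ::
  "ordering_rule \<Rightarrow> nat \<Rightarrow> (nat \<Rightarrow> nat) \<Rightarrow> nat \<times> nat \<Rightarrow> nat \<times> nat" where
  "next_state Q d x = (\<lambda>(I, B).
     (I + Q I B - (B + d), \<Sum>l = 1..(B + d) - (I + Q I B). x l))"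

text \<open>\<open>state Q D \<xi> I1 B0 n \<omega>\<close> is the state at the beginning of period \<open>n + 1\<close>.\<close>

primrec state ::
  "ordering_rule \<Rightarrow> (nat \<Rightarrow> 'a \<Rightarrow> nat) \<Rightarrow> (nat \<Rightarrow> nat \<Rightarrow> 'a \<Rightarrow> nat) \<Rightarrow> nat \<Rightarrow> nat \<Rightarrow>
     nat \<Rightarrow> 'a \<Rightarrow> nat \<times> nat" where
  "state Q D \<xi> I1 B0 0 \<omega> = (I1, B0)"
| "state Q D \<xi> I1 B0 (Suc n) \<omega> =
     next_state Q (D (Suc n) \<omega>) (\<lambda>l. \<xi> (Suc n) l \<omega>) (state Q D \<xi> I1 B0 n \<omega>)"

definition period_profit ::
  "ordering_rule \<Rightarrow> real \<Rightarrow> real \<Rightarrow> nat \<Rightarrow> nat \<times> nat \<Rightarrow> real" where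
  "period_profit Q r h d = (\<lambda>(I, B).
     r * real (min (I + Q I B) (B + d)) - h * real (I + Q I B - (B + d)))"

definition average_profit ::
  "'a measure \<Rightarrow> (nat \<Rightarrow> 'a \<Rightarrow> nat) \<Rightarrow> (nat \<Rightarrow> nat \<Rightarrow> 'a \<Rightarrow> nat) \<Rightarrow>
     ordering_rule \<Rightarrow> real \<Rightarrow> real \<Rightarrow> nat \<Rightarrow> nat \<Rightarrow> ereal" where
  "average_profit M D \<xi> Q r h I1 B0 =
     liminf (\<lambda>N. ereal (1 / real N *
       (LINT \<omega>|M. (\<Sum>i = 1..N.
          period_profit Q r h (D i \<omega>) (state Q D \<xi> I1 B0 (i - 1) \<omega>)))))"

definition base_stock_profit ::
  "'a measure \<Rightarrow> (nat \<Rightarrow> 'a \<Rightarrow> nat) \<Rightarrow> (nat \<Rightarrow> nat \<Rightarrow> 'a \<Rightarrow> nat) \<Rightarrow>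
     real \<Rightarrow> real \<Rightarrow> nat \<Rightarrow> nat \<Rightarrow> nat \<Rightarrow> ereal" where
  "base_stock_profit M D \<xi> r h I1 B0 s = average_profit M D \<xi> (base_stock s) r h I1 B0"

definition sq_profit ::
  "'a measure \<Rightarrow> (nat \<Rightarrow> 'a \<Rightarrow> nat) \<Rightarrow> (nat \<Rightarrow> nat \<Rightarrow> 'a \<Rightarrow> nat) \<Rightarrow>
     real \<Rightarrow> real \<Rightarrow> nat \<Rightarrow> nat \<Rightarrow> nat \<times> nat \<Rightarrow> ereal" where
  "sq_profit M D \<xi> r h I1 B0 = (\<lambda>(s, q). average_profit M D \<xi> (sq_rule s q) r h I1 B0)"

end

theory Submission
  imports Defs
begin

text \<open>
  Write \<open>Y\<close> for the on-hand inventory after ordering. Units that are sold are demanded at some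
  point, so the sales up to period \<open>N\<close> are at most \<open>B\<^sub>0 + D\<^sub>1 + \<dots> + D\<^sub>N\<close>; hence the base-stock policy
  earns at most \<open>r \<cdot> E D - h \<cdot> E (s - D)\<^sup>+\<close> per period. Conversely, every policy that orders up to at
  least \<open>s\<close> but leaves a net inventory of at most \<open>s\<close> earns at least
  \<open>r \<cdot> E (min s D) - h \<cdot> E (s - D)\<^sup>+\<close>, once an initial excess over \<open>s\<close> has been depleted. Both the
  base-stock policy and the \<open>(s, 0)\<close>-policy are of this kind, and the two bounds differ by
  \<open>r \<cdot> E (D - s)\<^sup>+\<close>; thus \<open>\<nu> = 1\<close> works. The lower bound divided by \<open>r\<close> tends to \<open>E D\<close> as first \<open>r\<close>
  and then \<open>s\<close> grows, which gives asymptotic optimality.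

  For the existence of an optimal pair \<open>(s, q)\<close>: sales plus leftover equal \<open>Y \<ge> s\<close>, so large \<open>s\<close> is
  unprofitable. For fixed \<open>s\<close> with \<open>P (D \<ge> max s 1) > 0\<close> the inventory keeps returning to \<open>0\<close>, which
  makes its average grow with \<open>q\<close>; otherwise \<open>q = 0\<close> already attains the general upper bound.
\<close>

section \<open>Pathwise bounds on sales, inventory and profit\<close>

definition post_order :: "ordering_rule \<Rightarrow> nat \<times> nat \<Rightarrow> nat" where
  "post_order Q x = fst x + Q (fst x) (snd x)"

definition sales :: "ordering_rule \<Rightarrow> nat \<Rightarrow> nat \<times> nat \<Rightarrow> nat" where
  "sales Q d x = min (post_order Q x) (snd x + d)"

definition leftover :: "ordering_rule \<Rightarrow> nat \<Rightarrow> nat \<times> nat \<Rightarrow> nat" where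
  "leftover Q d x = post_order Q x - (snd x + d)"

lemma period_profit_eq:
  "period_profit Q r h d x = r * real (sales Q d x) - h * real (leftover Q d x)"
  by (simp add: period_profit_def sales_def leftover_def post_order_def case_prod_beta)

lemma leftover_eq: "real (leftover Q d x) = real (post_order Q x) - real (sales Q d x)"
  by (auto simp: leftover_def sales_def min_def)

lemma fst_next_state: "fst (next_state Q d x y) = leftover Q d y"
  by (simp add: next_state_def leftover_def post_order_def case_prod_beta)

text \<open>Each unmet unit is backordered at most once, so sold and backordered units together
  never exceed the backlog plus the new demand. The backlog thus serves as a potential that
  telescopes over the periods in \<open>sum_sales_le\<close>.\<close>

lemma sales_next_state_le:
  assumes "\<And>l. l \<ge> 1 \<Longrightarrow> x l \<le> 1"
  shows "sales Q d y + snd (next_state Q d x y) \<le> snd y + d"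
proof -
  have "(\<Sum>l = 1..k. x l) \<le> k" for k :: nat
    using sum_bounded_above[of "{1..k}" x 1] assms by auto
  from this[of "snd y + d - post_order Q y"] show ?thesis
    by (auto simp: next_state_def sales_def post_order_def case_prod_beta)
qed

lemma sum_sales_le:
  assumes "\<And>i l. i \<ge> 1 \<Longrightarrow> l \<ge> 1 \<Longrightarrow> \<xi> i l \<omega> \<le> 1"
  shows "(\<Sum>i = 1..N. sales Q (D i \<omega>) (state Q D \<xi> I1 B0 (i - 1) \<omega>))
           + snd (state Q D \<xi> I1 B0 N \<omega>) \<le> B0 + (\<Sum>i = 1..N. D i \<omega>)"
proof (induction N)
  case (Suc N)
  have "sales Q (D (Suc N) \<omega>) (state Q D \<xi> I1 B0 N \<omega>) + snd (state Q D \<xi> I1 B0 (Suc N) \<omega>)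
      \<le> snd (state Q D \<xi> I1 B0 N \<omega>) + D (Suc N) \<omega>"
    using sales_next_state_le[of "\<lambda>l. \<xi> (Suc N) l \<omega>"] assms by simp
  with Suc show ?case by simp
qed simp

text \<open>The backlog \<open>B\<close> is served within the period, so stock ordered up to at most
  \<open>K + B\<close> leaves at most \<open>K\<close>.\<close>

lemma inventory_le:
  assumes "\<And>I B. I \<le> K \<Longrightarrow> I + Q I B \<le> K + B" and "I1 \<le> K"
  shows "fst (state Q D \<xi> I1 B0 n \<omega>) \<le> K"
proof (induction n)
  case (Suc n)
  show ?case
    using assms(1)[OF Suc, of "snd (state Q D \<xi> I1 B0 n \<omega>)"]
    by (auto simp: fst_next_state leftover_def post_order_def)
qed (use assms in simp)

text \<open>Ordering never creates net stock above \<open>s\<close>. Any excess is therefore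
  inherited from \<open>I1\<close>, and every demanded unit reduces it until it vanishes.\<close>

lemma excess_inventory_le:
  assumes "\<And>I B. I + Q I B \<le> max I (s + B)"
  shows "fst (state Q D \<xi> I1 B0 n \<omega>) - s \<le> I1 - (\<Sum>i = 1..n. D i \<omega>)"
proof (induction n)
  case (Suc n)
  show ?case
    using Suc assms[of "fst (state Q D \<xi> I1 B0 n \<omega>)" "snd (state Q D \<xi> I1 B0 n \<omega>)"]
    by (auto simp: fst_next_state leftover_def post_order_def)
qed simp

text \<open>Stock of at least \<open>s\<close> sells at least \<open>min s d\<close>. The leftover
  splits into the part \<open>s - d\<close> that level \<open>s\<close> would leave and the
  inherited excess \<open>I - s\<close>.\<close>

lemma period_profit_ge:
  assumes "s \<le> I + Q I B" "I + Q I B \<le> max I (s + B)" "r \<ge> 0" "h \<ge> 0"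
  shows "r * real (min s d) - h * real (s - d) - h * real (I - s) \<le> period_profit Q r h d (I, B)"
proof -
  have "min s d \<le> sales Q d (I, B)" "leftover Q d (I, B) \<le> (s - d) + (I - s)"
    using assms(1,2) by (auto simp: sales_def leftover_def post_order_def)
  then have "r * real (min s d) \<le> r * real (sales Q d (I, B))"
    "h * real (leftover Q d (I, B)) \<le> h * (real (s - d) + real (I - s))"
    using assms(3,4) by (auto intro!: mult_left_mono simp flip: of_nat_add)
  then show ?thesis by (simp add: period_profit_eq algebra_simps)
qed

text \<open>
  Below level \<open>L\<close>, a demand of at least \<open>max s 1\<close> lowers the truncated inventory \<open>min Y L\<close> or empties
  the stock; an empty stock is refilled to at least \<open>q\<close>, and this large \<open>Y\<close> pays for the jump of
  \<open>min Y L\<close>.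
\<close>

lemma sq_rule_sawtooth_step:
  fixes s q L :: nat
  defines "Y \<equiv> post_order (sq_rule s q)"
  assumes "L\<^sup>2 + L \<le> q"
  shows "L * of_bool (d \<ge> max s 1) + L * min (Y (next_state (sq_rule s q) d x y)) L
           \<le> L * min (Y y) L + Y y + Y (next_state (sq_rule s q) d x y)"
proof -
  let ?z = "next_state (sq_rule s q) d x y"
  have z: "fst ?z = Y y - (snd y + d)" by (simp add: fst_next_state leftover_def Y_def)
  have Yy: "s \<le> Y y" by (simp add: Y_def post_order_def sq_rule_def)
  show ?thesis
  proof (cases "fst ?z = 0")
    case True
    \<comment> \<open>The refilled stock alone pays for everything: \<open>L\<close> for the
      indicator and at most \<open>L * L\<close> for the jump of the potential. This is where
      \<open>L\<^sup>2 + L\<close> comes from.\<close>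
    then have "Y ?z \<ge> q" by (simp add: Y_def post_order_def sq_rule_def)
    moreover have "L * of_bool (d \<ge> max s 1) \<le> L" "L * min (Y ?z) L \<le> L * L" by auto
    ultimately show ?thesis using assms(2) by (simp add: power2_eq_square)
  next
    case False
    then have Yz: "Y ?z = max (fst ?z) s" by (simp add: Y_def post_order_def sq_rule_def)
    show ?thesis
    proof (cases "d \<ge> max s 1")
      case c: True
      \<comment> \<open>Both entries of \<open>max s 1\<close> matter: \<open>d \<ge> 1\<close>
        makes the leftover smaller than \<open>Y y\<close>, and \<open>d \<ge> s\<close> with stock
        remaining forces \<open>Y y > s\<close>.\<close>
      then have le: "Y ?z + 1 \<le> Y y" using Yz z False by auto
      show ?thesis
      proof (cases "Y y \<le> L")
        case True
        then have "L * (1 + min (Y ?z) L) \<le> L * min (Y y) L"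
          using le by (intro mult_le_mono) auto
        then show ?thesis using c by simp
      next
        case False
        \<comment> \<open>Above \<open>L\<close> the truncated inventory need not drop; there the
          summand \<open>Y y\<close> itself covers the \<open>L\<close> of the indicator.\<close>
        then have "L * min (Y ?z) L \<le> L * min (Y y) L" by (intro mult_le_mono) auto
        moreover have "L * of_bool (d \<ge> max s 1) \<le> Y y" using False by simp
        ultimately show ?thesis by linarith
      qed
    next
      case c: False
      have "Y ?z \<le> Y y" using Yz z Yy by auto
      then have "L * min (Y ?z) L \<le> L * min (Y y) L" by (intro mult_le_mono) auto
      moreover have "L * of_bool (d \<ge> max s 1) = 0" using c by simp
      ultimately show ?thesis by linarith
    qed
  qed
qed

text \<open>Summing the one-step inequality telescopes the potential, which starts at no more than
  \<open>L\<^sup>2\<close>. Intermediate values of \<open>Y\<close> occur once as predecessor and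
  once as successor, hence the factor 2; the last one occurs only as successor.\<close>

lemma sq_rule_sawtooth:
  fixes s q L :: nat
  defines "Y \<equiv> post_order (sq_rule s q)"
  assumes "L\<^sup>2 + L \<le> q"
  shows "L * (\<Sum>i = 1..N. of_bool (D i \<omega> \<ge> max s 1))
           + L * min (Y (state (sq_rule s q) D \<xi> I1 B0 N \<omega>)) L
         \<le> L\<^sup>2 + 2 * (\<Sum>i = 1..N. Y (state (sq_rule s q) D \<xi> I1 B0 (i - 1) \<omega>))
           + Y (state (sq_rule s q) D \<xi> I1 B0 N \<omega>)"
proof (induction N)
  case 0
  show ?case by (simp add: power2_eq_square trans_le_add1)
next
  case (Suc N)
  from Suc sq_rule_sawtooth_step[OF assms(2), of s "D (Suc N) \<omega>" "\<lambda>l. \<xi> (Suc N) l \<omega>"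
     "state (sq_rule s q) D \<xi> I1 B0 N \<omega>"]
  show ?case by (simp add: Y_def distrib_left)
qed

section \<open>Maxima over infinite index sets and the limit in the price\<close>

lemma ex_is_arg_max_dominating_set:
  fixes f :: "'a \<Rightarrow> 'b :: linorder"
  assumes "finite A" and dom: "\<And>y. \<exists>x\<in>A. f y \<le> f x"
  shows "\<exists>x. is_arg_max f (\<lambda>_. True) x"
proof -
  have "A \<noteq> {}" using dom by blast
  then have "Max (f ` A) \<in> f ` A" using assms(1) by (intro Max_in) auto
  then obtain x where "x \<in> A" "f x = Max (f ` A)" by auto
  then have "f y \<le> f x" if "y \<in> A" for y using assms(1) that by simp
  then show ?thesis using dom unfolding is_arg_max_linorder by (meson order_trans)
qed

lemma ereal_le_0I: "x \<le> ereal e \<Longrightarrow> e \<le> 0 \<Longrightarrow> x \<le> 0"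
  by (erule order_trans) simp

lemma SUP_eq_arg_max:
  fixes f :: "'a \<Rightarrow> 'b :: complete_linorder"
  assumes "is_arg_max f (\<lambda>_. True) x"
  shows "(SUP y. f y) = f x"
  using assms by (intro SUP_eqI) (auto simp: is_arg_max_linorder)

lemma tendsto_between_linear_bounds:
  fixes f :: "real \<Rightarrow> real" and m :: "nat \<Rightarrow> real"
  assumes m: "m \<longlonglongrightarrow> d"
    and lower: "\<And>r s. r > 0 \<Longrightarrow> r * m s - h * real s \<le> f r"
    and upper: "\<And>r. r > 0 \<Longrightarrow> f r \<le> r * d"
  shows "((\<lambda>r. f r / r) \<longlongrightarrow> d) at_top"
proof (rule order_tendstoI)
  fix a assume "a < d"
  \<comment> \<open>The level is fixed first, so that \<open>m s\<close> already exceeds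
    \<open>a\<close>; then the holding term \<open>h * s / r\<close> vanishes as \<open>r\<close>
    grows.\<close>
  from order_tendstoD(1)[OF m this] obtain s where s: "a < m s"
    by (auto simp: eventually_sequentially)
  have "((\<lambda>r. m s - h * real s / r) \<longlongrightarrow> m s - 0) at_top"
    by (intro tendsto_intros tendsto_divide_0[OF tendsto_const] filterlim_at_top_imp_at_infinity
        filterlim_ident)
  then have "eventually (\<lambda>r. a < m s - h * real s / r) at_top"
    using s by (intro order_tendstoD(1)) auto
  then show "eventually (\<lambda>r. a < f r / r) at_top"
    using eventually_gt_at_top[of "0::real"]
  proof eventually_elim
    case (elim r)
    have "m s - h * real s / r \<le> f r / r"
      using divide_right_mono[OF lower[of r s], of r] elim(2) by (simp add: diff_divide_distrib)
    with elim(1) show ?case by simp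
  qed
next
  fix a assume "d < a"
  show "eventually (\<lambda>r. f r / r < a) at_top"
    using eventually_gt_at_top[of "0::real"]
  proof eventually_elim
    case (elim r)
    then have "f r / r \<le> d" using divide_right_mono[OF upper[of r], of r] by simp
    then show ?case using \<open>d < a\<close> by simp
  qed
qed

text \<open>Both functions grow like \<open>r * d\<close>. After division of numerator and
  denominator by \<open>r\<close>, the quotient tends to \<open>(d - d) / d\<close>.\<close>

lemma relative_gap_tendsto_0:
  fixes b q :: "real \<Rightarrow> ereal" and m :: "nat \<Rightarrow> real"
  assumes "m \<longlonglongrightarrow> d" and "d > 0"
    and b: "\<And>r s. r > 0 \<Longrightarrow> ereal (r * m s - h * real s) \<le> b r"
      "\<And>r. r > 0 \<Longrightarrow> b r \<le> ereal (r * d)"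
    and q: "\<And>r s. r > 0 \<Longrightarrow> ereal (r * m s - h * real s) \<le> q r"
      "\<And>r. r > 0 \<Longrightarrow> q r \<le> ereal (r * d)"
  shows "((\<lambda>r. (b r - q r) / b r) \<longlongrightarrow> 0) at_top"
proof -
  define b' where "b' = (\<lambda>r. real_of_ereal (b r))"
  define q' where "q' = (\<lambda>r. real_of_ereal (q r))"
  have b': "b r = ereal (b' r)" if "r > 0" for r
    \<comment> \<open>Any single level gives a finite lower bound, which together with the upper
      bound excludes the infinite values.\<close>
    using b(1)[OF that, of 0] b(2)[OF that] unfolding b'_def by (cases "b r") auto
  have q': "q r = ereal (q' r)" if "r > 0" for r
    using q(1)[OF that, of 0] q(2)[OF that] unfolding q'_def by (cases "q r") auto
  have lim_b: "((\<lambda>r. b' r / r) \<longlongrightarrow> d) at_top"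
  proof (rule tendsto_between_linear_bounds[OF assms(1)])
    fix r :: real assume r: "r > 0"
    show "r * m s - h * real s \<le> b' r" for s using b(1)[OF r, of s] b'[OF r] by simp
    show "b' r \<le> r * d" using b(2)[OF r] b'[OF r] by simp
  qed
  have lim_q: "((\<lambda>r. q' r / r) \<longlongrightarrow> d) at_top"
  proof (rule tendsto_between_linear_bounds[OF assms(1)])
    fix r :: real assume r: "r > 0"
    show "r * m s - h * real s \<le> q' r" for s using q(1)[OF r, of s] q'[OF r] by simp
    show "q' r \<le> r * d" using q(2)[OF r] q'[OF r] by simp
  qed
  have "((\<lambda>r. (b' r / r - q' r / r) / (b' r / r)) \<longlongrightarrow> (d - d) / d) at_top"
    using \<open>d > 0\<close> by (intro tendsto_intros lim_b lim_q) simp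
  then have "((\<lambda>r. ereal ((b' r / r - q' r / r) / (b' r / r))) \<longlongrightarrow> 0) at_top"
    by (simp add: zero_ereal_def)
  \<comment> \<open>Since \<open>d > 0\<close>, the denominator is eventually positive, so
    extended-real and real division agree.\<close>
  moreover have "eventually (\<lambda>r. ereal ((b' r / r - q' r / r) / (b' r / r)) = (b r - q r) / b r) at_top"
    using order_tendstoD(1)[OF lim_b \<open>d > 0\<close>] eventually_gt_at_top[of "0::real"]
  proof eventually_elim
    case (elim r)
    then have "b' r > 0" by (simp add: zero_less_divide_iff)
    then show ?case using elim by (simp add: b' q' field_simps)
  qed
  ultimately show ?thesis by (rule Lim_transform_eventually)
qed

section \<open>Measurability and distribution of demands and states\<close>

context partial_backorder_system
begin

lemma measurable_demand: "i \<ge> 1 \<Longrightarrow> D i \<in> measurable M (count_space UNIV)"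
  using independent unfolding indep_vars_def by (auto dest: bspec[of _ _ "Inl i"])

lemma measurable_patience: "i \<ge> 1 \<Longrightarrow> l \<ge> 1 \<Longrightarrow> \<xi> i l \<in> measurable M (count_space UNIV)"
  using independent unfolding indep_vars_def by (auto dest: bspec[of _ _ "Inr (i, l)"])

text \<open>Only the law of each patience variable is known, so the bound holds off a null set;
  countably many such sets combine into one.\<close>

lemma AE_patience_le_1: "AE \<omega> in M. \<forall>i\<ge>1. \<forall>l\<ge>1. \<xi> i l \<omega> \<le> 1"
proof -
  have "AE \<omega> in M. \<xi> i l \<omega> \<le> 1" if "i \<ge> 1" "l \<ge> 1" for i l
  proof -
    have "AE x in distr M (count_space UNIV) (\<xi> i l). x \<le> 1"
      unfolding patience_bernoulli[OF that] by (auto simp: AE_measure_pmf_iff)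
    then show ?thesis using measurable_patience[OF that] by (subst (asm) AE_distr_iff) auto
  qed
  then show ?thesis by (simp add: AE_all_countable)
qed

lemma integrable_demand:
  fixes g :: "nat \<Rightarrow> real"
  assumes "i \<ge> 1" "integrable M (\<lambda>\<omega>. g (D 1 \<omega>))"
  shows "integrable M (\<lambda>\<omega>. g (D i \<omega>))"
  using assms(2) integrable_distr_eq[OF measurable_demand[OF assms(1)], of g]
    integrable_distr_eq[OF measurable_demand[of 1], of g]
    demand_identically_distributed[OF assms(1)] by simp

lemma expectation_demand:
  fixes g :: "nat \<Rightarrow> real"
  assumes "i \<ge> 1"
  shows "expectation (\<lambda>\<omega>. g (D i \<omega>)) = expectation (\<lambda>\<omega>. g (D 1 \<omega>))"
  using integral_distr[OF measurable_demand[OF assms], of g]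
    integral_distr[OF measurable_demand[of 1], of g]
    demand_identically_distributed[OF assms] by simp

lemma measurable_sum_count_space:
  fixes f :: "'i \<Rightarrow> 'a \<Rightarrow> nat"
  assumes "finite A" "\<And>i. i \<in> A \<Longrightarrow> f i \<in> measurable M (count_space UNIV)"
  shows "(\<lambda>\<omega>. \<Sum>i\<in>A. f i \<omega>) \<in> measurable M (count_space UNIV)"
  using assms
proof (induction A rule: finite_induct)
  case (insert x A)
  have "(\<lambda>\<omega>. f x \<omega> + a) \<in> measurable M (count_space UNIV)" for a
    by (rule measurable_compose[OF insert.prems[of x]]) simp_all
  from measurable_compose_countable[OF this insert.IH] insert show ?case by simp
qed simp

text \<open>The upper limit of the backorder sum is random. Demand and state are frozen to constants
  first and then released one at a time, which is possible because both take countably many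
  values.\<close>

lemma measurable_next_state:
  assumes "i \<ge> 1" "S \<in> measurable M (count_space UNIV)"
  shows "(\<lambda>\<omega>. next_state Q (D i \<omega>) (\<lambda>l. \<xi> i l \<omega>) (S \<omega>)) \<in> measurable M (count_space UNIV)"
proof -
  have sum: "(\<lambda>\<omega>. \<Sum>l = 1..k. \<xi> i l \<omega>) \<in> measurable M (count_space UNIV)" for k
    using assms(1) by (intro measurable_sum_count_space measurable_patience) auto
  have "(\<lambda>\<omega>. next_state Q d (\<lambda>l. \<xi> i l \<omega>) y) \<in> measurable M (count_space UNIV)" for d y
    unfolding next_state_def case_prod_beta
    by (rule measurable_compose[OF sum[of "snd y + d - (fst y + Q (fst y) (snd y))"]]) simp
  then have "(\<lambda>\<omega>. next_state Q (D i \<omega>) (\<lambda>l. \<xi> i l \<omega>) y) \<in> measurable M (count_space UNIV)" for y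
    by (rule measurable_compose_countable[OF _ measurable_demand[OF assms(1)]])
  then show ?thesis by (rule measurable_compose_countable[OF _ assms(2)])
qed

lemma measurable_state: "state Q D \<xi> I1 B0 n \<in> measurable M (count_space UNIV)"
proof (induction n)
  case (Suc n)
  then show ?case using measurable_next_state[of "Suc n"] by simp
qed simp

lemma measurable_total_profit:
  "(\<lambda>\<omega>. \<Sum>i = 1..N. period_profit Q r h (D i \<omega>) (state Q D \<xi> I1 B0 (i - 1) \<omega>))
     \<in> borel_measurable M"
proof (rule borel_measurable_sum)
  fix i assume "i \<in> {1..N}"
  then have i: "i \<ge> 1" by simp
  have "(\<lambda>\<omega>. period_profit Q r h d (state Q D \<xi> I1 B0 (i - 1) \<omega>)) \<in> borel_measurable M" for d
    by (rule measurable_compose[OF measurable_state]) simp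
  then show "(\<lambda>\<omega>. period_profit Q r h (D i \<omega>) (state Q D \<xi> I1 B0 (i - 1) \<omega>)) \<in> borel_measurable M"
    by (rule measurable_compose_countable[OF _ measurable_demand[OF i]])
qed

section \<open>Total profit and its long-run average\<close>

definition total_profit ::
  "ordering_rule \<Rightarrow> real \<Rightarrow> real \<Rightarrow> nat \<Rightarrow> nat \<Rightarrow> nat \<Rightarrow> 'a \<Rightarrow> real" where
  "total_profit Q r h I1 B0 N \<omega> =
     (\<Sum>i = 1..N. period_profit Q r h (D i \<omega>) (state Q D \<xi> I1 B0 (i - 1) \<omega>))"

lemma average_profit_eq:
  "average_profit M D \<xi> Q r h I1 B0 =
     liminf (\<lambda>N. ereal (1 / real N * expectation (total_profit Q r h I1 B0 N)))"
  unfolding average_profit_def total_profit_def ..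

lemma total_profit_eq:
  "total_profit Q r h I1 B0 N \<omega> =
     r * real (\<Sum>i = 1..N. sales Q (D i \<omega>) (state Q D \<xi> I1 B0 (i - 1) \<omega>))
     - h * real (\<Sum>i = 1..N. leftover Q (D i \<omega>) (state Q D \<xi> I1 B0 (i - 1) \<omega>))"
  by (simp add: total_profit_def period_profit_eq sum_subtractf sum_distrib_left)

lemma AE_sum_sales_le:
  "AE \<omega> in M. real (\<Sum>i = 1..N. sales Q (D i \<omega>) (state Q D \<xi> I1 B0 (i - 1) \<omega>))
     \<le> real B0 + (\<Sum>i = 1..N. real (D i \<omega>))"
  using AE_patience_le_1
proof eventually_elim
  case (elim \<omega>)
  have "(\<Sum>i = 1..N. sales Q (D i \<omega>) (state Q D \<xi> I1 B0 (i - 1) \<omega>)) \<le> B0 + (\<Sum>i = 1..N. D i \<omega>)"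
    using sum_sales_le[of \<xi> \<omega> Q D I1 B0 N] elim by auto
  then show ?case by (simp flip: of_nat_add of_nat_sum)
qed

lemma integrable_sum_demand:
  assumes "integrable M (\<lambda>\<omega>. g (D 1 \<omega>) :: real)"
  shows "integrable M (\<lambda>\<omega>. \<Sum>i = 1..N. g (D i \<omega>))"
  by (intro Bochner_Integration.integrable_sum integrable_demand[of _ g, OF _ assms]) simp

lemma expectation_sum_demand:
  assumes "integrable M (\<lambda>\<omega>. g (D 1 \<omega>) :: real)"
  shows "expectation (\<lambda>\<omega>. \<Sum>i = 1..N. g (D i \<omega>)) = real N * expectation (\<lambda>\<omega>. g (D 1 \<omega>))"
proof -
  have "expectation (\<lambda>\<omega>. \<Sum>i = 1..N. g (D i \<omega>)) = (\<Sum>i = 1..N. expectation (\<lambda>\<omega>. g (D i \<omega>)))"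
    by (intro Bochner_Integration.integral_sum integrable_demand[of _ g, OF _ assms]) simp
  also have "\<dots> = (\<Sum>i = 1..N. expectation (\<lambda>\<omega>. g (D 1 \<omega>)))"
    by (intro sum.cong refl expectation_demand[of _ g]) simp
  finally show ?thesis by simp
qed

text \<open>Total sales are dominated by the initial backlog plus total demand, and each leftover by
  the invariant inventory bound \<open>K\<close>.\<close>

lemma integrable_total_profit:
  assumes Q: "\<And>I B. I \<le> K \<Longrightarrow> I + Q I B \<le> K + B" and "I1 \<le> K" "r \<ge> 0" "h \<ge> 0"
  shows "integrable M (total_profit Q r h I1 B0 N)"
proof (rule Bochner_Integration.integrable_bound)
  show "integrable M (\<lambda>\<omega>. r * (real B0 + (\<Sum>i = 1..N. real (D i \<omega>))) + h * (real N * real K))"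
    using integrable_sum_demand[of real N] demand_finite_mean by simp
  show "total_profit Q r h I1 B0 N \<in> borel_measurable M"
    using measurable_total_profit[where N = N] by (simp add: total_profit_def[abs_def])
  show "AE \<omega> in M. norm (total_profit Q r h I1 B0 N \<omega>)
      \<le> norm (r * (real B0 + (\<Sum>i = 1..N. real (D i \<omega>))) + h * (real N * real K))"
    using AE_sum_sales_le[of Q I1 B0 N]
  proof eventually_elim
    case (elim \<omega>)
    let ?S = "\<Sum>i = 1..N. sales Q (D i \<omega>) (state Q D \<xi> I1 B0 (i - 1) \<omega>)"
    let ?H = "\<Sum>i = 1..N. leftover Q (D i \<omega>) (state Q D \<xi> I1 B0 (i - 1) \<omega>)"
    have "leftover Q d (state Q D \<xi> I1 B0 n \<omega>) \<le> K" for d n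
      using Q[OF inventory_le[of K Q I1 D \<xi> B0 n \<omega>, OF Q assms(2)],
          of "snd (state Q D \<xi> I1 B0 n \<omega>)"]
      by (auto simp: leftover_def post_order_def)
    then have "?H \<le> N * K" using sum_bounded_above[of "{1..N}" _ K] by simp
    then have "h * real ?H \<le> h * (real N * real K)"
      using assms(4) by (intro mult_left_mono) (simp_all del: of_nat_sum flip: of_nat_mult)
    moreover have "r * real ?S \<le> r * (real B0 + (\<Sum>i = 1..N. real (D i \<omega>)))"
      using elim assms(3) by (intro mult_left_mono) auto
    moreover have "0 \<le> h * real ?H" "0 \<le> r * real ?S"
      by (intro mult_nonneg_nonneg assms of_nat_0_le_iff)+
    moreover have "\<bar>x - y\<bar> \<le> \<bar>u + v\<bar>" if "y \<le> v" "x \<le> u" "0 \<le> y" "0 \<le> x" for x y u v :: real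
      using that by linarith
    ultimately show ?case unfolding total_profit_eq real_norm_def by blast
  qed
qed

text \<open>The constant \<open>C\<close> collects boundary effects such as the initial backlog;
  division by \<open>N\<close> makes it vanish, and identical distribution turns the remaining sum
  into one expectation.\<close>

lemma average_profit_le:
  fixes g :: "nat \<Rightarrow> real"
  assumes "\<And>N. integrable M (total_profit Q r h I1 B0 N)"
    and "\<And>N. AE \<omega> in M. total_profit Q r h I1 B0 N \<omega> \<le> C + (\<Sum>i = 1..N. g (D i \<omega>))"
    and g: "integrable M (\<lambda>\<omega>. g (D 1 \<omega>))"
  shows "average_profit M D \<xi> Q r h I1 B0 \<le> ereal (expectation (\<lambda>\<omega>. g (D 1 \<omega>)))"
proof -
  let ?m = "expectation (\<lambda>\<omega>. g (D 1 \<omega>))"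
  have "expectation (total_profit Q r h I1 B0 N) \<le> C + real N * ?m" for N
  proof -
    have "expectation (total_profit Q r h I1 B0 N)
        \<le> expectation (\<lambda>\<omega>. C + (\<Sum>i = 1..N. g (D i \<omega>)))"
      using integrable_sum_demand[OF g, of N] assms(2)
      by (intro integral_mono_AE Bochner_Integration.integrable_add assms(1)) auto
    also have "\<dots> = C + real N * ?m"
      using integrable_sum_demand[OF g, of N] by (simp add: prob_space expectation_sum_demand[OF g] del: One_nat_def)
    finally show ?thesis .
  qed
  then have "1 / real N * expectation (total_profit Q r h I1 B0 N) \<le> C / real N + ?m" if "N > 0" for N
    using that by (simp add: field_simps)
  then have "average_profit M D \<xi> Q r h I1 B0 \<le> liminf (\<lambda>N. ereal (C / real N + ?m))"
    unfolding average_profit_eq by (intro Liminf_mono eventually_sequentiallyI[of 1]) auto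
  also have "(\<lambda>N. C / real N + ?m) \<longlonglongrightarrow> 0 + ?m"
    by (intro tendsto_intros lim_const_over_n)
  then have "liminf (\<lambda>N. ereal (C / real N + ?m)) = ereal ?m"
    by (intro lim_imp_Liminf) auto
  finally show ?thesis .
qed

text \<open>The correction \<open>R\<close> is random and may vary with \<open>N\<close>, but its
  expectation stays below a fixed \<open>C\<close>, which suffices for it to disappear in the
  average. It is meant for the cost of the initial excess inventory.\<close>

lemma average_profit_ge:
  fixes g :: "nat \<Rightarrow> real" and R :: "nat \<Rightarrow> 'a \<Rightarrow> real"
  assumes "\<And>N. integrable M (total_profit Q r h I1 B0 N)"
    and "\<And>N \<omega>. (\<Sum>i = 1..N. g (D i \<omega>)) - R N \<omega> \<le> total_profit Q r h I1 B0 N \<omega>"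
    and g: "integrable M (\<lambda>\<omega>. g (D 1 \<omega>))"
    and R: "\<And>N. integrable M (R N)" "\<And>N. expectation (R N) \<le> C"
  shows "ereal (expectation (\<lambda>\<omega>. g (D 1 \<omega>))) \<le> average_profit M D \<xi> Q r h I1 B0"
proof -
  let ?m = "expectation (\<lambda>\<omega>. g (D 1 \<omega>))"
  have "real N * ?m - C \<le> expectation (total_profit Q r h I1 B0 N)" for N
  proof -
    have "real N * ?m - C \<le> expectation (\<lambda>\<omega>. \<Sum>i = 1..N. g (D i \<omega>)) - expectation (R N)"
      using R(2)[of N] unfolding expectation_sum_demand[OF g] by linarith
    also have "\<dots> = expectation (\<lambda>\<omega>. (\<Sum>i = 1..N. g (D i \<omega>)) - R N \<omega>)"
      by (rule Bochner_Integration.integral_diff[symmetric, OF integrable_sum_demand[OF g] R(1)])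
    also have "\<dots> \<le> expectation (total_profit Q r h I1 B0 N)"
      by (rule integral_mono[OF Bochner_Integration.integrable_diff[OF integrable_sum_demand[OF g] R(1)]
            assms(1,2)])
    finally show ?thesis .
  qed
  then have "?m - C / real N \<le> 1 / real N * expectation (total_profit Q r h I1 B0 N)" if "N > 0" for N
    using divide_right_mono[of "real N * ?m - C" "expectation (total_profit Q r h I1 B0 N)" "real N"] that
    by (simp add: diff_divide_distrib)
  then have "liminf (\<lambda>N. ereal (?m - C / real N)) \<le> average_profit M D \<xi> Q r h I1 B0"
    unfolding average_profit_eq by (intro Liminf_mono eventually_sequentiallyI[of 1]) auto
  moreover have "(\<lambda>N. ?m - C / real N) \<longlonglongrightarrow> ?m - 0"
    by (intro tendsto_intros lim_const_over_n)
  then have "liminf (\<lambda>N. ereal (?m - C / real N)) = ereal ?m"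
    by (intro lim_imp_Liminf) auto
  ultimately show ?thesis by simp
qed

section \<open>Depletion of the initial excess\<close>

lemma expectation_power_total_demand:
  fixes x :: real
  assumes "0 \<le> x" "x \<le> 1"
  shows "integrable M (\<lambda>\<omega>. x ^ (\<Sum>i = 1..n. D i \<omega>))"
    and "expectation (\<lambda>\<omega>. x ^ (\<Sum>i = 1..n. D i \<omega>)) = expectation (\<lambda>\<omega>. x ^ D 1 \<omega>) ^ n"
proof -
  let ?V = "\<lambda>k. case k of Inl i \<Rightarrow> D i | Inr (i, l) \<Rightarrow> \<xi> i l"
  let ?J = "Inl ` {1..n} :: (nat + nat \<times> nat) set"
  \<comment> \<open>Restricting the joint family to the first \<open>n\<close> demands makes the
    generating function of their sum factorize.\<close>
  have indep: "indep_vars (\<lambda>_. borel) (\<lambda>k \<omega>. x ^ ?V k \<omega>) ?J"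
    by (rule indep_vars_compose2[OF indep_vars_subset[OF independent]]) auto
  have eq: "(\<Prod>k\<in>?J. x ^ ?V k \<omega>) = x ^ (\<Sum>i = 1..n. D i \<omega>)" for \<omega>
    by (subst prod.reindex) (auto simp: power_sum)
  have int: "integrable M (\<lambda>\<omega>. x ^ D i \<omega>)" if "i \<ge> 1" for i
    using assms measurable_demand[OF that]
    by (intro integrable_const_bound[of _ 1] AE_I2)
       (auto intro!: power_le_one measurable_compose[OF measurable_demand[OF that]] simp: abs_mult)
  have int': "integrable M (\<lambda>\<omega>. x ^ ?V k \<omega>)" if "k \<in> ?J" for k
    using that int by auto
  show "integrable M (\<lambda>\<omega>. x ^ (\<Sum>i = 1..n. D i \<omega>))"
    using indep_vars_integrable[OF _ indep int'] unfolding eq by simp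
  have "expectation (\<lambda>\<omega>. x ^ (\<Sum>i = 1..n. D i \<omega>)) = (\<Prod>k\<in>?J. expectation (\<lambda>\<omega>. x ^ ?V k \<omega>))"
    using indep_vars_lebesgue_integral[OF _ indep int'] unfolding eq by simp
  also have "\<dots> = (\<Prod>i = 1..n. expectation (\<lambda>\<omega>. x ^ D i \<omega>))"
    by (subst prod.reindex) auto
  also have "\<dots> = (\<Prod>i = 1..n. expectation (\<lambda>\<omega>. x ^ D 1 \<omega>))"
    by (intro prod.cong refl expectation_demand[of _ "\<lambda>k. x ^ k"]) simp
  finally show "expectation (\<lambda>\<omega>. x ^ (\<Sum>i = 1..n. D i \<omega>)) = expectation (\<lambda>\<omega>. x ^ D 1 \<omega>) ^ n"
    by simp
qed

text \<open>The power is at most 1 everywhere and equals \<open>1/2\<close> where the demand is 1,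
  an event of positive probability.\<close>

lemma expectation_half_power_demand_less_1:
  assumes "prob {\<omega> \<in> space M. D 1 \<omega> = 1} > 0"
  shows "expectation (\<lambda>\<omega>. (1/2) ^ D 1 \<omega>) < (1::real)"
proof -
  let ?A = "{\<omega> \<in> space M. D 1 \<omega> = 1}"
  note [measurable] = measurable_demand[OF order_refl]
  have A: "?A \<in> sets M" by measurable
  then have int: "integrable M (\<lambda>\<omega>. 1 - 1/2 * indicator ?A \<omega> :: real)"
    by (intro Bochner_Integration.integrable_diff integrable_mult_right integrable_const
        integrable_real_indicator) (simp_all add: emeasure_eq_measure)
  have "expectation (\<lambda>\<omega>. (1/2) ^ D 1 \<omega>) \<le> expectation (\<lambda>\<omega>. 1 - 1/2 * indicator ?A \<omega> :: real)"
    using expectation_power_total_demand(1)[of "1/2" 1]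
    by (intro integral_mono int) (auto simp: indicator_def power_le_one)
  also have "\<dots> = 1 - 1/2 * prob ?A"
    using A int by (subst Bochner_Integration.integral_diff) (simp_all add: prob_space emeasure_eq_measure)
  finally show ?thesis using assms by simp
qed

text \<open>The excess after \<open>n\<close> periods is at most a constant times
  \<open>(1/2)\<close> to the total demand. By independence the expectation of this power is
  \<open>?\<rho> ^ n\<close> with \<open>?\<rho> < 1\<close>, so a geometric series bounds the sum
  uniformly in \<open>N\<close>.\<close>

lemma transient_excess_bounded:
  assumes "prob {\<omega> \<in> space M. D 1 \<omega> = 1} > 0"
  obtains C :: real
  where "\<And>N. integrable M (\<lambda>\<omega>. \<Sum>n<N. real (I1 - (\<Sum>i = 1..n. D i \<omega>)))"
    and "\<And>N. expectation (\<lambda>\<omega>. \<Sum>n<N. real (I1 - (\<Sum>i = 1..n. D i \<omega>))) \<le> C"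
proof -
  let ?\<rho> = "expectation (\<lambda>\<omega>. (1/2) ^ D 1 \<omega> :: real)"
  let ?Z = "\<lambda>n \<omega>. real (I1 - (\<Sum>i = 1..n. D i \<omega>))"
  define c where "c = real I1 * 2 ^ I1"
  have \<rho>: "0 \<le> ?\<rho>" "?\<rho> < 1" using expectation_half_power_demand_less_1[OF assms] by simp_all
  have bound: "?Z n \<omega> \<le> c * (1/2) ^ (\<Sum>i = 1..n. D i \<omega>)" for n \<omega>
  proof (cases "(\<Sum>i = 1..n. D i \<omega>) \<le> I1")
    case True
    have "?Z n \<omega> \<le> real I1 * 2 ^ (I1 - (\<Sum>i = 1..n. D i \<omega>))"
      using mult_mono[of "?Z n \<omega>" "real I1" 1 "2 ^ (I1 - (\<Sum>i = 1..n. D i \<omega>)) :: real"] by simp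
    also have "\<dots> = c * (1/2) ^ (\<Sum>i = 1..n. D i \<omega>)"
      using True by (simp add: c_def power_diff power_one_over)
    finally show ?thesis .
  qed (simp add: c_def)
  have meas: "(\<lambda>\<omega>. ?Z n \<omega>) \<in> borel_measurable M" for n
    by (rule measurable_compose[OF measurable_sum_count_space[of "{1..n}" D]])
      (simp_all add: measurable_demand)
  have int: "integrable M (?Z n)" for n
    using meas by (intro integrable_const_bound[of _ "real I1"] AE_I2) auto
  have "expectation (\<lambda>\<omega>. \<Sum>n<N. ?Z n \<omega>) \<le> c / (1 - ?\<rho>)" for N
  proof -
    have "expectation (\<lambda>\<omega>. \<Sum>n<N. ?Z n \<omega>) = (\<Sum>n<N. expectation (?Z n))"
      using int by (intro Bochner_Integration.integral_sum) auto
    also have "\<dots> \<le> (\<Sum>n<N. expectation (\<lambda>\<omega>. c * (1/2) ^ (\<Sum>i = 1..n. D i \<omega>)))"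
      using expectation_power_total_demand(1)[of "1/2"] bound int
      by (intro sum_mono integral_mono) auto
    also have "\<dots> = c * (\<Sum>n<N. ?\<rho> ^ n)"
      by (simp add: expectation_power_total_demand(2)[of "1/2", simplified] sum_distrib_left)
    also have "\<dots> \<le> c * (1 / (1 - ?\<rho>))"
      using \<rho> sum_le_suminf[OF summable_geometric[of ?\<rho>], of "{..<N}"]
      by (intro mult_left_mono) (auto simp: suminf_geometric c_def)
    finally show ?thesis by simp
  qed
  with int \<rho> show thesis by (intro that[of "c / (1 - ?\<rho>)"]) auto
qed

section \<open>Profit bounds for both policies\<close>

lemma integrable_demand_dominated:
  fixes g :: "nat \<Rightarrow> real"
  assumes "\<And>k. \<bar>g k\<bar> \<le> a + b * real k"
  shows "integrable M (\<lambda>\<omega>. g (D 1 \<omega>))"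
proof (rule Bochner_Integration.integrable_bound[where f = "\<lambda>\<omega>. a + b * real (D 1 \<omega>)"])
  show "integrable M (\<lambda>\<omega>. a + b * real (D 1 \<omega>))" using demand_finite_mean by simp
  show "(\<lambda>\<omega>. g (D 1 \<omega>)) \<in> borel_measurable M"
    by (rule measurable_compose[OF measurable_demand]) simp_all
  show "AE \<omega> in M. norm (g (D 1 \<omega>)) \<le> norm (a + b * real (D 1 \<omega>))"
    by (intro AE_I2) (use assms in \<open>auto intro: order_trans[OF _ abs_ge_self]\<close>)
qed

lemma integrable_indicator_demand: "integrable M (\<lambda>\<omega>. of_bool (P (D 1 \<omega>)) :: real)"
  by (rule integrable_demand_dominated[of _ 1 0]) simp

lemma integrable_min_demand: "integrable M (\<lambda>\<omega>. real (min s (D 1 \<omega>)))"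
  by (rule integrable_demand_dominated[of "\<lambda>k. real (min s k)" "real s" 0]) simp

lemma integrable_leftover: "integrable M (\<lambda>\<omega>. real (s - D 1 \<omega>))"
  by (rule integrable_demand_dominated[of "\<lambda>k. real (s - k)" "real s" 0]) simp

lemmas integrable_demand_functions =
  demand_finite_mean integrable_indicator_demand integrable_min_demand integrable_leftover

text \<open>This covers the base-stock rule and the \<open>(s, 0)\<close>-rule at once. The extra
  holding cost of the initial excess is the correction \<open>R\<close>, with expectation at most
  \<open>h * C\<close> for every horizon.\<close>

lemma average_profit_ge_order_up_to:
  assumes Q: "\<And>I B. s \<le> I + Q I B" "\<And>I B. I + Q I B \<le> max I (s + B)"
    and "r \<ge> 0" "h \<ge> 0" and "prob {\<omega> \<in> space M. D 1 \<omega> = 1} > 0"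
  shows "ereal (expectation (\<lambda>\<omega>. r * real (min s (D 1 \<omega>)) - h * real (s - D 1 \<omega>)))
           \<le> average_profit M D \<xi> Q r h I1 B0"
proof -
  obtain C where C: "\<And>N. integrable M (\<lambda>\<omega>. \<Sum>n<N. real (I1 - (\<Sum>i = 1..n. D i \<omega>)))"
    "\<And>N. expectation (\<lambda>\<omega>. \<Sum>n<N. real (I1 - (\<Sum>i = 1..n. D i \<omega>))) \<le> C"
    using transient_excess_bounded[OF assms(5)] by metis
  show ?thesis
  proof (rule average_profit_ge[where g = "\<lambda>k. r * real (min s k) - h * real (s - k)"
        and R = "\<lambda>N \<omega>. h * (\<Sum>n<N. real (I1 - (\<Sum>i = 1..n. D i \<omega>)))" and C = "h * C"])
    fix N \<omega>
    have "I + Q I B \<le> max I1 s + B" if "I \<le> max I1 s" for I B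
      using Q(2)[of I B] that by linarith
    then show "integrable M (total_profit Q r h I1 B0 N)"
      by (rule integrable_total_profit) (use assms in auto)
    have "(\<Sum>i = 1..N. r * real (min s (D i \<omega>)) - h * real (s - D i \<omega>))
        - h * (\<Sum>n<N. real (I1 - (\<Sum>i = 1..n. D i \<omega>)))
      = (\<Sum>n<N. r * real (min s (D (Suc n) \<omega>)) - h * real (s - D (Suc n) \<omega>)
          - h * real (I1 - (\<Sum>i = 1..n. D i \<omega>)))"
      \<comment> \<open>The index shift pairs the demand of period \<open>Suc n\<close> with state
        \<open>n\<close>, whose excess has been reduced by the first \<open>n\<close> demands
        only.\<close>
      unfolding One_nat_def sum.atLeast1_atMost_eq by (simp only: sum_subtractf sum_distrib_left)
    also have "\<dots> \<le> (\<Sum>n<N. period_profit Q r h (D (Suc n) \<omega>) (state Q D \<xi> I1 B0 n \<omega>))"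
    proof (rule sum_mono)
      fix n
      obtain I B where st: "state Q D \<xi> I1 B0 n \<omega> = (I, B)" by fastforce
      have "h * real (I - s) \<le> h * real (I1 - (\<Sum>i = 1..n. D i \<omega>))"
        using excess_inventory_le[of Q s D \<xi> I1 B0 n \<omega>, OF Q(2)] st assms(4)
        by (intro mult_left_mono) auto
      with period_profit_ge[of s I Q B r h "D (Suc n) \<omega>"] Q assms(3,4)
      show "r * real (min s (D (Suc n) \<omega>)) - h * real (s - D (Suc n) \<omega>)
          - h * real (I1 - (\<Sum>i = 1..n. D i \<omega>))
        \<le> period_profit Q r h (D (Suc n) \<omega>) (state Q D \<xi> I1 B0 n \<omega>)"
        unfolding st by fastforce
    qed
    also have "\<dots> = total_profit Q r h I1 B0 N \<omega>"
      unfolding total_profit_def One_nat_def sum.atLeast1_atMost_eq by simp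
    finally show "(\<Sum>i = 1..N. r * real (min s (D i \<omega>)) - h * real (s - D i \<omega>))
        - h * (\<Sum>n<N. real (I1 - (\<Sum>i = 1..n. D i \<omega>))) \<le> total_profit Q r h I1 B0 N \<omega>" .
  next
    show "integrable M (\<lambda>\<omega>. r * real (min s (D 1 \<omega>)) - h * real (s - D 1 \<omega>))"
      by (intro Bochner_Integration.integrable_diff integrable_mult_right integrable_demand_functions)
  qed (use C assms(4) in \<open>auto intro: mult_left_mono\<close>)
qed

lemma base_stock_profit_ge:
  assumes "r \<ge> 0" "h \<ge> 0" "prob {\<omega> \<in> space M. D 1 \<omega> = 1} > 0"
  shows "ereal (expectation (\<lambda>\<omega>. r * real (min s (D 1 \<omega>)) - h * real (s - D 1 \<omega>)))
           \<le> base_stock_profit M D \<xi> r h I1 B0 s"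
  unfolding base_stock_profit_def
  by (rule average_profit_ge_order_up_to) (use assms in \<open>auto simp: base_stock_def\<close>)

lemma sq_profit_ge:
  assumes "r \<ge> 0" "h \<ge> 0" "prob {\<omega> \<in> space M. D 1 \<omega> = 1} > 0"
  shows "ereal (expectation (\<lambda>\<omega>. r * real (min s (D 1 \<omega>)) - h * real (s - D 1 \<omega>)))
           \<le> sq_profit M D \<xi> r h I1 B0 (s, 0)"
  unfolding sq_profit_def split
  by (rule average_profit_ge_order_up_to) (use assms in \<open>auto simp: sq_rule_def\<close>)

lemma base_stock_profit_le:
  assumes "r \<ge> 0" "h \<ge> 0"
  shows "base_stock_profit M D \<xi> r h I1 B0 s
           \<le> ereal (expectation (\<lambda>\<omega>. r * real (D 1 \<omega>) - h * real (s - D 1 \<omega>)))"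
  unfolding base_stock_profit_def
proof (rule average_profit_le[where g = "\<lambda>k. r * real k - h * real (s - k)" and C = "r * real B0"])
  fix N
  let ?Q = "base_stock s"
  show "integrable M (total_profit ?Q r h I1 B0 N)"
    by (rule integrable_total_profit[of "max I1 s"]) (use assms in \<open>auto simp: base_stock_def\<close>)
  show "AE \<omega> in M. total_profit ?Q r h I1 B0 N \<omega>
      \<le> r * real B0 + (\<Sum>i = 1..N. r * real (D i \<omega>) - h * real (s - D i \<omega>))"
    using AE_sum_sales_le[of ?Q I1 B0 N]
  proof eventually_elim
    case (elim \<omega>)
    \<comment> \<open>The base-stock order covers the backlog in addition to \<open>s\<close>, so
      after serving the backlog at least \<open>s\<close> units face the new demand.\<close>
    have "(\<Sum>i = 1..N. s - D i \<omega>) \<le> (\<Sum>i = 1..N. leftover ?Q (D i \<omega>) (state ?Q D \<xi> I1 B0 (i - 1) \<omega>))"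
      by (rule sum_mono) (auto simp: leftover_def post_order_def base_stock_def)
    then have "h * (\<Sum>i = 1..N. real (s - D i \<omega>))
        \<le> h * real (\<Sum>i = 1..N. leftover ?Q (D i \<omega>) (state ?Q D \<xi> I1 B0 (i - 1) \<omega>))"
      using assms(2) by (intro mult_left_mono) (simp_all flip: of_nat_sum)
    moreover note mult_left_mono[OF elim assms(1)]
    ultimately show ?case
      unfolding total_profit_eq sum_subtractf sum_distrib_left[symmetric] distrib_left by linarith
  qed
qed (intro Bochner_Integration.integrable_diff integrable_mult_right integrable_demand_functions)

lemma integrable_sq_total_profit:
  assumes "r \<ge> 0" "h \<ge> 0"
  shows "integrable M (total_profit (sq_rule s q) r h I1 B0 N)"
  by (rule integrable_total_profit[of "max I1 (s + q)"]) (use assms in \<open>auto simp: sq_rule_def\<close>)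

lemma sq_profit_le_sales:
  assumes "r \<ge> 0" "h \<ge> 0"
  shows "sq_profit M D \<xi> r h I1 B0 (s, q) \<le> ereal (expectation (\<lambda>\<omega>. r * real (D 1 \<omega>)))"
  unfolding sq_profit_def split
proof (rule average_profit_le[where g = "\<lambda>k. r * real k" and C = "r * real B0"])
  fix N
  let ?Q = "sq_rule s q"
  show "AE \<omega> in M. total_profit ?Q r h I1 B0 N \<omega> \<le> r * real B0 + (\<Sum>i = 1..N. r * real (D i \<omega>))"
    using AE_sum_sales_le[of ?Q I1 B0 N]
  proof eventually_elim
    case (elim \<omega>)
    have "0 \<le> h * real (\<Sum>i = 1..N. leftover ?Q (D i \<omega>) (state ?Q D \<xi> I1 B0 (i - 1) \<omega>))"
      by (intro mult_nonneg_nonneg assms of_nat_0_le_iff)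
    moreover note mult_left_mono[OF elim assms(1)]
    ultimately show ?case
      unfolding total_profit_eq sum_distrib_left[symmetric] distrib_left by linarith
  qed
qed (intro integrable_sq_total_profit assms integrable_mult_right integrable_demand_functions)+

text \<open>Writing leftover as stock minus sales turns every lower bound on the post-order stock
  into an upper bound on profit, at a rate of \<open>r + h\<close> per unit sold.\<close>

lemma total_profit_eq_post_order:
  "total_profit Q r h I1 B0 N \<omega> =
     (r + h) * real (\<Sum>i = 1..N. sales Q (D i \<omega>) (state Q D \<xi> I1 B0 (i - 1) \<omega>))
     - h * real (\<Sum>i = 1..N. post_order Q (state Q D \<xi> I1 B0 (i - 1) \<omega>))"
  unfolding total_profit_eq by (simp add: leftover_eq sum_subtractf algebra_simps)

lemma sq_profit_le:
  assumes "r \<ge> 0" "h \<ge> 0"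
  shows "sq_profit M D \<xi> r h I1 B0 (s, q)
           \<le> ereal (expectation (\<lambda>\<omega>. (r + h) * real (D 1 \<omega>) - h * real s))"
  unfolding sq_profit_def split
proof (rule average_profit_le[where g = "\<lambda>k. (r + h) * real k - h * real s" and C = "(r + h) * real B0"])
  fix N
  let ?Q = "sq_rule s q"
  show "AE \<omega> in M. total_profit ?Q r h I1 B0 N \<omega>
      \<le> (r + h) * real B0 + (\<Sum>i = 1..N. (r + h) * real (D i \<omega>) - h * real s)"
    using AE_sum_sales_le[of ?Q I1 B0 N]
  proof eventually_elim
    case (elim \<omega>)
    have "(\<Sum>i = 1..N. s) \<le> (\<Sum>i = 1..N. post_order ?Q (state ?Q D \<xi> I1 B0 (i - 1) \<omega>))"
      by (rule sum_mono) (auto simp: post_order_def sq_rule_def)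
    then have "h * (\<Sum>i = 1..N. real s)
        \<le> h * real (\<Sum>i = 1..N. post_order ?Q (state ?Q D \<xi> I1 B0 (i - 1) \<omega>))"
      using assms(2) by (intro mult_left_mono) (simp_all flip: of_nat_sum of_nat_mult)
    moreover have "0 \<le> r + h" using assms by simp
    note mult_left_mono[OF elim this]
    ultimately show ?case
      unfolding total_profit_eq_post_order sum_subtractf sum_distrib_left[symmetric] distrib_left by linarith
  qed
qed (intro integrable_sq_total_profit assms Bochner_Integration.integrable_diff integrable_mult_right
    integrable_demand_functions integrable_const)+

text \<open>The sawtooth inequality bounds the total stock below by about \<open>L / 2\<close> per
  period with demand at least \<open>max s 1\<close>. Its boundary terms depend on \<open>q\<close>
  but not on \<open>N\<close>, so they go into the constant.\<close>

lemma sq_profit_le_large_q: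
  fixes L :: nat
  assumes "r \<ge> 0" "h \<ge> 0" "L\<^sup>2 + L \<le> q"
  shows "sq_profit M D \<xi> r h I1 B0 (s, q)
           \<le> ereal (expectation (\<lambda>\<omega>. (r + h) * real (D 1 \<omega>)
                                        - h / 2 * real L * of_bool (D 1 \<omega> \<ge> max s 1)))"
  unfolding sq_profit_def split
proof (rule average_profit_le[where g = "\<lambda>k. (r + h) * real k - h / 2 * real L * of_bool (k \<ge> max s 1)"
      and C = "(r + h) * real B0 + h / 2 * (real (L\<^sup>2) + real (max I1 (s + q)))"])
  fix N
  let ?Q = "sq_rule s q"
  show "AE \<omega> in M. total_profit ?Q r h I1 B0 N \<omega>
      \<le> (r + h) * real B0 + h / 2 * (real (L\<^sup>2) + real (max I1 (s + q)))
        + (\<Sum>i = 1..N. (r + h) * real (D i \<omega>) - h / 2 * real L * of_bool (D i \<omega> \<ge> max s 1))"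
    using AE_sum_sales_le[of ?Q I1 B0 N]
  proof eventually_elim
    case (elim \<omega>)
    let ?Y = "\<lambda>n. post_order ?Q (state ?Q D \<xi> I1 B0 n \<omega>)"
    have "fst (state ?Q D \<xi> I1 B0 N \<omega>) \<le> max I1 (s + q)"
      by (rule inventory_le) (auto simp: sq_rule_def)
    then have "?Y N \<le> max I1 (s + q)" by (auto simp: post_order_def sq_rule_def)
    with sq_rule_sawtooth[OF assms(3), of s D \<omega> N \<xi> I1 B0]
    have "L * (\<Sum>i = 1..N. of_bool (D i \<omega> \<ge> max s 1))
        \<le> L\<^sup>2 + 2 * (\<Sum>i = 1..N. ?Y (i - 1)) + max I1 (s + q)" by linarith
    then have "real (L * (\<Sum>i = 1..N. of_bool (D i \<omega> \<ge> max s 1)))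
        \<le> real (L\<^sup>2 + 2 * (\<Sum>i = 1..N. ?Y (i - 1)) + max I1 (s + q))"
      by (rule of_nat_mono)
    then have "real L * (\<Sum>i = 1..N. of_bool (D i \<omega> \<ge> max s 1))
        \<le> real (L\<^sup>2) + 2 * real (\<Sum>i = 1..N. ?Y (i - 1)) + real (max I1 (s + q))"
      by (simp only: of_nat_mult of_nat_add of_nat_sum of_nat_of_bool of_nat_numeral)
    then have "h / 2 * (real L * (\<Sum>i = 1..N. of_bool (D i \<omega> \<ge> max s 1)))
        \<le> h / 2 * (real (L\<^sup>2) + 2 * real (\<Sum>i = 1..N. ?Y (i - 1)) + real (max I1 (s + q)))"
      using assms(2) by (intro mult_left_mono) auto
    then have "h / 2 * real L * (\<Sum>i = 1..N. of_bool (D i \<omega> \<ge> max s 1))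
        \<le> h / 2 * (real (L\<^sup>2) + real (max I1 (s + q))) + h * real (\<Sum>i = 1..N. ?Y (i - 1))"
      by (simp add: distrib_left mult.assoc del: of_nat_sum of_nat_max)
    moreover have "0 \<le> r + h" using assms by simp
    note mult_left_mono[OF elim this]
    ultimately show ?case
      unfolding total_profit_eq_post_order sum_subtractf sum_distrib_left[symmetric] distrib_left[of "r + h"]
      by linarith
  qed
qed (intro integrable_sq_total_profit assms Bochner_Integration.integrable_diff integrable_mult_right
    integrable_demand_functions)+

section \<open>Mean demand and its truncations\<close>

lemma demand_mean_pos:
  assumes "prob {\<omega> \<in> space M. D 1 \<omega> = 1} > 0"
  shows "expectation (\<lambda>\<omega>. real (D 1 \<omega>)) > 0"
proof -
  let ?A = "{\<omega> \<in> space M. D 1 \<omega> = 1}"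
  note [measurable] = measurable_demand[OF order_refl]
  have A: "?A \<in> sets M" by measurable
  then have "prob ?A = expectation (indicator ?A)" by simp
  also have "\<dots> \<le> expectation (\<lambda>\<omega>. real (D 1 \<omega>))"
    using A by (intro integral_mono integrable_real_indicator demand_finite_mean)
      (auto simp: emeasure_eq_measure indicator_def)
  finally show ?thesis using assms by simp
qed

lemma mean_min_demand_tendsto:
  "(\<lambda>s. expectation (\<lambda>\<omega>. real (min s (D 1 \<omega>)))) \<longlonglongrightarrow> expectation (\<lambda>\<omega>. real (D 1 \<omega>))"
proof (rule integral_dominated_convergence[where w = "\<lambda>\<omega>. real (D 1 \<omega>)"])
  show "AE \<omega> in M. (\<lambda>s. real (min s (D 1 \<omega>))) \<longlonglongrightarrow> real (D 1 \<omega>)"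
  proof (intro AE_I2 tendsto_eventually)
    show "\<forall>\<^sub>F s in sequentially. real (min s (D 1 \<omega>)) = real (D 1 \<omega>)" for \<omega>
      using eventually_ge_at_top[of "D 1 \<omega>"] by eventually_elim simp
  qed
qed (use demand_finite_mean integrable_min_demand in auto)

text \<open>Bounding the leftover by \<open>s\<close> brings the profit bound into the form required
  by \<open>relative_gap_tendsto_0\<close>.\<close>

lemma order_up_to_bound_ge:
  assumes "h \<ge> 0"
  shows "r * expectation (\<lambda>\<omega>. real (min s (D 1 \<omega>))) - h * real s
    \<le> expectation (\<lambda>\<omega>. r * real (min s (D 1 \<omega>)) - h * real (s - D 1 \<omega>))"
proof -
  have "expectation (\<lambda>\<omega>. r * real (min s (D 1 \<omega>)) - h * real s)
      \<le> expectation (\<lambda>\<omega>. r * real (min s (D 1 \<omega>)) - h * real (s - D 1 \<omega>))"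
    using assms
    by (intro integral_mono Bochner_Integration.integrable_diff integrable_mult_right
        integrable_demand_functions integrable_const) (auto intro!: mult_left_mono)
  also have "expectation (\<lambda>\<omega>. r * real (min s (D 1 \<omega>)) - h * real s)
      = r * expectation (\<lambda>\<omega>. real (min s (D 1 \<omega>))) - h * real s"
    using integrable_min_demand[of s] by (simp add: prob_space)
  finally show ?thesis .
qed

section \<open>Existence of optimal parameters\<close>

lemma base_stock_maximizer_exists:
  assumes "r > 0" "h > 0" and d1: "prob {\<omega> \<in> space M. D 1 \<omega> = 1} > 0"
  shows "\<exists>s. is_arg_max (base_stock_profit M D \<xi> r h I1 B0) (\<lambda>_. True) s"
proof -
  let ?f = "base_stock_profit M D \<xi> r h I1 B0"
  let ?d = "expectation (\<lambda>\<omega>. real (D 1 \<omega>))"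
  \<comment> \<open>From \<open>S\<close> on, the upper profit bound is at most
    \<open>(r + h) * ?d - h * s \<le> 0\<close>, whereas level 0 earns at least 0. Only levels up to
    \<open>S\<close> remain.\<close>
  obtain S :: nat where S: "(r + h) * ?d < real S * h" using reals_Archimedean3[OF assms(2)] by blast
  have "?f s \<le> ?f 0" if "s \<ge> S" for s
  proof -
    have "expectation (\<lambda>\<omega>. r * real (D 1 \<omega>) - h * real (s - D 1 \<omega>))
        \<le> expectation (\<lambda>\<omega>. (r + h) * real (D 1 \<omega>) - h * real s)" (is "?E \<le> _")
    proof (intro integral_mono Bochner_Integration.integrable_diff integrable_mult_right
        integrable_demand_functions integrable_const)
      fix \<omega>
      have "h * (real s - real (D 1 \<omega>)) \<le> h * real (s - D 1 \<omega>)"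
        using assms(2) by (intro mult_left_mono) auto
      then show "r * real (D 1 \<omega>) - h * real (s - D 1 \<omega>) \<le> (r + h) * real (D 1 \<omega>) - h * real s"
        by (simp add: algebra_simps)
    qed
    also have "\<dots> = (r + h) * ?d - h * real s"
      using demand_finite_mean by (simp add: prob_space)
    also have "real S * h \<le> real s * h" using that assms(2) by (intro mult_right_mono) auto
    then have "(r + h) * ?d - h * real s \<le> 0" using S mult.commute[of h "real s"] by linarith
    finally have E: "?E \<le> 0" .
    have "?f s \<le> 0"
      by (rule ereal_le_0I[OF base_stock_profit_le E]) (use assms in auto)
    also have "0 \<le> ?f 0"
      using base_stock_profit_ge[of r h 0 I1 B0] assms by (simp add: zero_ereal_def)
    finally show ?thesis .
  qed
  then have "\<exists>x\<in>{..S}. ?f y \<le> ?f x" for y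
    by (cases "y \<le> S") (blast, metis atMost_iff le0 nle_le)
  then show ?thesis by (intro ex_is_arg_max_dominating_set[of "{..S}"]) auto
qed

lemma sq_profit_dominated:
  assumes "r > 0" "h > 0" and d1: "prob {\<omega> \<in> space M. D 1 \<omega> = 1} > 0"
  shows "\<exists>q0. \<forall>q\<ge>q0. sq_profit M D \<xi> r h I1 B0 (s, q) \<le> sq_profit M D \<xi> r h I1 B0 (s, 0) \<or>
                     sq_profit M D \<xi> r h I1 B0 (s, q) \<le> 0"
proof -
  let ?d = "expectation (\<lambda>\<omega>. real (D 1 \<omega>))"
  let ?\<beta> = "expectation (\<lambda>\<omega>. of_bool (D 1 \<omega> \<ge> max s 1) :: real)"
  have "?\<beta> \<ge> 0" by simp
  then consider "?\<beta> > 0" | "?\<beta> = 0" by linarith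
  then show ?thesis
  proof cases
    case 1
    then have "h / 2 * ?\<beta> > 0" using assms(2) by simp
    from reals_Archimedean3[OF this] obtain L :: nat
      \<comment> \<open>\<open>L\<close> is large enough for the sawtooth holding cost to outweigh
        \<open>(r + h) * ?d\<close>, the largest possible gain.\<close>
      where L: "(r + h) * ?d < real L * (h / 2 * ?\<beta>)" by blast
    have "sq_profit M D \<xi> r h I1 B0 (s, q) \<le> 0" if "q \<ge> L\<^sup>2 + L" for q
    proof -
      have "expectation (\<lambda>\<omega>. (r + h) * real (D 1 \<omega>) - h / 2 * real L * of_bool (D 1 \<omega> \<ge> max s 1))
          = (r + h) * ?d - h / 2 * real L * ?\<beta>" (is "?E = _")
        using demand_finite_mean integrable_indicator_demand[of "\<lambda>k. k \<ge> max s 1"]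
        by (subst Bochner_Integration.integral_diff) auto
      also have "\<dots> \<le> 0" using L by (simp add: algebra_simps)
      finally have E: "?E \<le> 0" .
      show ?thesis by (rule ereal_le_0I[OF sq_profit_le_large_q E]) (use that assms in auto)
    qed
    then show ?thesis by blast
  next
    case 2
    then have "AE \<omega> in M. of_bool (D 1 \<omega> \<ge> max s 1) = (0::real)"
      by (subst (asm) integral_nonneg_eq_0_iff_AE[OF integrable_indicator_demand]) simp_all
    then have AE: "AE \<omega> in M. D 1 \<omega> < max s 1" by eventually_elim auto
    have "sq_profit M D \<xi> r h I1 B0 (s, q) \<le> sq_profit M D \<xi> r h I1 B0 (s, 0)" for q
    proof -
      \<comment> \<open>Almost surely \<open>D 1 < max s 1\<close>, hence \<open>D 1 \<le> s\<close>
        (also for \<open>s = 0\<close>). The upper bound for every \<open>q\<close> then coincides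
        with the lower bound for \<open>q = 0\<close>.\<close>
      have "expectation (\<lambda>\<omega>. (r + h) * real (D 1 \<omega>) - h * real s)
          = expectation (\<lambda>\<omega>. r * real (min s (D 1 \<omega>)) - h * real (s - D 1 \<omega>))"
      proof (rule integral_cong_AE)
        show "AE \<omega> in M. (r + h) * real (D 1 \<omega>) - h * real s
            = r * real (min s (D 1 \<omega>)) - h * real (s - D 1 \<omega>)"
          using AE
        proof eventually_elim
          case (elim \<omega>)
          then have "D 1 \<omega> \<le> s" by linarith
          then have "min s (D 1 \<omega>) = D 1 \<omega>" "real (s - D 1 \<omega>) = real s - real (D 1 \<omega>)"
            by simp_all
          then show ?case by (simp only: right_diff_distrib distrib_right)
        qed
      qed (rule borel_measurable_integrable, intro Bochner_Integration.integrable_diff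
          integrable_mult_right integrable_demand_functions integrable_const)+
      then show ?thesis
        using sq_profit_le[of r h I1 B0 s q] sq_profit_ge[of r h s I1 B0] assms by simp
    qed
    then show ?thesis by blast
  qed
qed

lemma sq_maximizer_exists:
  assumes "r > 0" "h > 0" and d1: "prob {\<omega> \<in> space M. D 1 \<omega> = 1} > 0"
  shows "\<exists>sq. is_arg_max (sq_profit M D \<xi> r h I1 B0) (\<lambda>_. True) sq"
proof -
  let ?f = "sq_profit M D \<xi> r h I1 B0"
  let ?d = "expectation (\<lambda>\<omega>. real (D 1 \<omega>))"
  obtain S :: nat where S: "(r + h) * ?d < real S * h" using reals_Archimedean3[OF assms(2)] by blast
  obtain q0 where q0: "\<And>s q. q \<ge> q0 s \<Longrightarrow> ?f (s, q) \<le> ?f (s, 0) \<or> ?f (s, q) \<le> 0"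
    using sq_profit_dominated[OF assms, of I1 B0] by metis
  have f0: "0 \<le> ?f (0, 0)"
    using sq_profit_ge[of r h 0 I1 B0] assms by (simp add: zero_ereal_def)
  \<comment> \<open>The threshold in \<open>q\<close> may depend on \<open>s\<close>, but only
    finitely many \<open>s\<close> matter. The pair \<open>(0, 0)\<close>, with nonnegative profit,
    dominates all pairs whose profit is at most 0.\<close>
  let ?A = "insert (0, 0) (SIGMA s:{..S}. {..q0 s})"
  have "\<exists>x\<in>?A. ?f y \<le> ?f x" for y
  proof -
    obtain s q where y: "y = (s, q)" by fastforce
    consider "s \<ge> S" | "s < S" "q \<le> q0 s" | "s < S" "q \<ge> q0 s" by linarith
    then show ?thesis
    proof cases
      case 1
      have "expectation (\<lambda>\<omega>. (r + h) * real (D 1 \<omega>) - h * real s) = (r + h) * ?d - h * real s"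
        (is "?E = _") using demand_finite_mean by (simp add: prob_space)
      also have "real S * h \<le> real s * h" using 1 assms(2) by (intro mult_right_mono) auto
      then have "(r + h) * ?d - h * real s \<le> 0" using S mult.commute[of h "real s"] by linarith
      finally have E: "?E \<le> 0" .
      have "?f y \<le> 0"
        unfolding y by (rule ereal_le_0I[OF sq_profit_le E]) (use assms in auto)
      with f0 show ?thesis by force
    next
      case 2
      then show ?thesis unfolding y by force
    next
      case 3
      from q0[OF 3(2)] show ?thesis
      proof
        assume "?f (s, q) \<le> ?f (s, 0)"
        then show ?thesis using 3 unfolding y by (intro bexI[of _ "(s, 0)"]) auto
      next
        assume "?f (s, q) \<le> 0"
        then have "?f y \<le> ?f (0, 0)" using f0 y by simp
        then show ?thesis by blast
      qed
    qed
  qed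
  then show ?thesis by (intro ex_is_arg_max_dominating_set[of ?A]) auto
qed

section \<open>The absolute and the relative profit gap\<close>

lemma profit_gap_le:
  assumes "r > 0" "h > 0" and d1: "prob {\<omega> \<in> space M. D 1 \<omega> = 1} > 0"
    and opt: "is_arg_max (base_stock_profit M D \<xi> r h I1 B0) (\<lambda>_. True) s"
  shows "(SUP s. base_stock_profit M D \<xi> r h I1 B0 s) - (SUP sq. sq_profit M D \<xi> r h I1 B0 sq)
           \<le> ereal (r * expectation (\<lambda>\<omega>. real (D 1 \<omega> - s)))"
proof -
  let ?u = "\<lambda>\<omega>. r * real (D 1 \<omega>) - h * real (s - D 1 \<omega>)"
  let ?l = "\<lambda>\<omega>. r * real (min s (D 1 \<omega>)) - h * real (s - D 1 \<omega>)"
  have "(SUP s. base_stock_profit M D \<xi> r h I1 B0 s) \<le> ereal (expectation ?u)"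
    unfolding SUP_eq_arg_max[OF opt] using assms by (intro base_stock_profit_le) auto
  \<comment> \<open>The pair \<open>(s, 0)\<close> with the optimal base-stock level serves as
    competitor. The holding terms of both bounds then cancel and leave
    \<open>D 1 - min s (D 1)\<close>.\<close>
  moreover have "ereal (expectation ?l) \<le> (SUP sq. sq_profit M D \<xi> r h I1 B0 sq)"
    using assms by (intro SUP_upper2[of "(s, 0)"] sq_profit_ge) auto
  ultimately have "(SUP s. base_stock_profit M D \<xi> r h I1 B0 s) - (SUP sq. sq_profit M D \<xi> r h I1 B0 sq)
      \<le> ereal (expectation ?u) - ereal (expectation ?l)"
    by (rule ereal_minus_mono)
  also have "\<dots> = ereal (expectation (\<lambda>\<omega>. ?u \<omega> - ?l \<omega>))"
    unfolding ereal_minus(1)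
    by (subst Bochner_Integration.integral_diff[of M ?u ?l])
      (intro Bochner_Integration.integrable_diff integrable_mult_right integrable_demand_functions refl)+
  also have "(\<lambda>\<omega>. ?u \<omega> - ?l \<omega>) = (\<lambda>\<omega>. r * real (D 1 \<omega> - s))"
  proof
    fix \<omega>
    have "real (D 1 \<omega>) = real (min s (D 1 \<omega>)) + real (D 1 \<omega> - s)"
      by (simp flip: of_nat_add)
    then show "?u \<omega> - ?l \<omega> = r * real (D 1 \<omega> - s)" by (simp add: algebra_simps)
  qed
  finally show ?thesis by simp
qed

lemma relative_profit_gap_tendsto_0:
  assumes "h > 0" and d1: "prob {\<omega> \<in> space M. D 1 \<omega> = 1} > 0"
  shows "((\<lambda>r. ((SUP s. base_stock_profit M D \<xi> r h I1 B0 s) - (SUP sq. sq_profit M D \<xi> r h I1 B0 sq))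
            / (SUP s. base_stock_profit M D \<xi> r h I1 B0 s)) \<longlongrightarrow> 0) at_top"
proof (rule relative_gap_tendsto_0[where h = h, OF mean_min_demand_tendsto demand_mean_pos[OF d1]])
  fix r :: real and s :: nat
  assume r: "r > 0"
  let ?l = "ereal (expectation (\<lambda>\<omega>. r * real (min s (D 1 \<omega>)) - h * real (s - D 1 \<omega>)))"
  have l: "ereal (r * expectation (\<lambda>\<omega>. real (min s (D 1 \<omega>))) - h * real s) \<le> ?l"
    using order_up_to_bound_ge[of h r s] assms by simp
  have "?l \<le> (SUP s. base_stock_profit M D \<xi> r h I1 B0 s)"
    using assms r by (intro SUP_upper2[of s] base_stock_profit_ge) auto
  with l show "ereal (r * expectation (\<lambda>\<omega>. real (min s (D 1 \<omega>))) - h * real s)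
      \<le> (SUP s. base_stock_profit M D \<xi> r h I1 B0 s)" by (rule order_trans)
  have "?l \<le> (SUP sq. sq_profit M D \<xi> r h I1 B0 sq)"
    using assms r by (intro SUP_upper2[of "(s, 0)"] sq_profit_ge) auto
  with l show "ereal (r * expectation (\<lambda>\<omega>. real (min s (D 1 \<omega>))) - h * real s)
      \<le> (SUP sq. sq_profit M D \<xi> r h I1 B0 sq)" by (rule order_trans)
next
  fix r :: real
  assume r: "r > 0"
  show "(SUP s. base_stock_profit M D \<xi> r h I1 B0 s) \<le> ereal (r * expectation (\<lambda>\<omega>. real (D 1 \<omega>)))"
  proof (rule SUP_least)
    fix s
    have "expectation (\<lambda>\<omega>. r * real (D 1 \<omega>) - h * real (s - D 1 \<omega>))
        \<le> expectation (\<lambda>\<omega>. r * real (D 1 \<omega>))"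
      using assms by (intro integral_mono Bochner_Integration.integrable_diff integrable_mult_right
          integrable_demand_functions) auto
    then have "ereal (expectation (\<lambda>\<omega>. r * real (D 1 \<omega>) - h * real (s - D 1 \<omega>)))
        \<le> ereal (r * expectation (\<lambda>\<omega>. real (D 1 \<omega>)))" by simp
    with base_stock_profit_le[of r h I1 B0 s] r assms
    show "base_stock_profit M D \<xi> r h I1 B0 s \<le> ereal (r * expectation (\<lambda>\<omega>. real (D 1 \<omega>)))"
      by (meson less_imp_le order_trans)
  qed
  show "(SUP sq. sq_profit M D \<xi> r h I1 B0 sq) \<le> ereal (r * expectation (\<lambda>\<omega>. real (D 1 \<omega>)))"
  proof (rule SUP_least)
    fix sq :: "nat \<times> nat"
    show "sq_profit M D \<xi> r h I1 B0 sq \<le> ereal (r * expectation (\<lambda>\<omega>. real (D 1 \<omega>)))"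
      using sq_profit_le_sales[of r h I1 B0 "fst sq" "snd sq"] r assms by simp
  qed
qed

end

theorem theorem3:
  fixes M :: "'a measure"
    and D :: "nat \<Rightarrow> 'a \<Rightarrow> nat"
    and \<xi> :: "nat \<Rightarrow> nat \<Rightarrow> 'a \<Rightarrow> nat"
    and p r h :: real
    and I1 B0 :: nat
  assumes system: "partial_backorder_system M D \<xi> p"
    and r_pos: "r > 0"
    and h_pos: "h > 0"
    and demand_0: "measure M {\<omega> \<in> space M. D 1 \<omega> = 0} > 0"
    and demand_1: "measure M {\<omega> \<in> space M. D 1 \<omega> = 1} > 0"
    and initial: "I1 * B0 = 0"
  shows
    "(\<exists>s. is_arg_max (base_stock_profit M D \<xi> r h I1 B0) (\<lambda>_. True) s) \<and>
     (\<exists>sq. is_arg_max (sq_profit M D \<xi> r h I1 B0) (\<lambda>_. True) sq) \<and>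
     (\<exists>\<nu>::real. \<nu> \<le> 1 \<and>
        (\<forall>s_opt. is_arg_max (base_stock_profit M D \<xi> r h I1 B0) (\<lambda>_. True) s_opt \<longrightarrow>
           (SUP s. base_stock_profit M D \<xi> r h I1 B0 s) - (SUP sq. sq_profit M D \<xi> r h I1 B0 sq)
             \<le> ereal (\<nu> * r * (LINT \<omega>|M. real (D 1 \<omega> - s_opt))))) \<and>
     ((\<lambda>r'. ((SUP s. base_stock_profit M D \<xi> r' h I1 B0 s)
               - (SUP sq. sq_profit M D \<xi> r' h I1 B0 sq))
             / (SUP s. base_stock_profit M D \<xi> r' h I1 B0 s)) \<longlongrightarrow> 0) at_top"
  proof -
  interpret partial_backorder_system M D \<xi> p by (rule system)
  note base = base_stock_maximizer_exists[OF r_pos h_pos demand_1]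
    and sq = sq_maximizer_exists[OF r_pos h_pos demand_1]
    and limit = relative_profit_gap_tendsto_0[OF h_pos demand_1]
    and gap = profit_gap_le[OF r_pos h_pos demand_1]
  show ?thesis
    \<comment> \<open>The witness for \<open>\<nu>\<close> is 1, uniformly over all optimal
      base-stock levels.\<close>
    by (rule conjI[OF base conjI[OF sq conjI[OF _ limit]]], rule exI[of _ 1])
      (simp only: mult_1 order_refl simp_thms, intro allI impI gap)
qed

end
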